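(* Let $R$ be a commutative ring with identity and let $\mathrm{X}(R)$ be an ideal space of $R$. Then $\mathrm{X}(R)$ is sober if and only if for every ideal $\mathfrak{a}$ of $R$ such that the subbasic closed set $\mathrm{h}(\mathfrak{a})$ is non-empty and irreducible, one has $\sqrt[\mathrm{X}]{\mathfrak{a}}\in \mathrm{h}(\mathfrak{a})$.
   Context: Rings are commutative with identity. $\mathrm{Idl}(R)$ is the set of all ideals of $R$. A spectrum $\mathrm{X}(R)$ of $R$ is an arbitrary class (set) of ideals of $R$ with $R\notin \mathrm{X}(R)$. For $\mathfrak{a}\in\mathrm{Idl}(R)$ put $\mathrm{h}(\mathfrak{a})=\{\mathfrak{s}\in \mathrm{X}(R)\mid \mathfrak{a}\subseteq \mathfrak{s}\}$; for $S\subseteq \mathrm{X}(R)$ put $\mathrm{k}(S)=\bigcap_{\mathfrak{s}\in S}\mathfrak{s}$ (with $\mathrm{k}(\emptyset)=R$). For $\mathfrak{a}\in\mathrm{Idl}(R)$ define the ideal $\sqrt[\mathrm{X}]{\mathfrak{a}}=\mathrm{k}(\mathrm{h}(\mathfrak{a}))$, the intersection of all members of $\mathrm{X}(R)$ containing $\mathfrak{a}$. The ideal space $\mathrm{X}(R)$ is the set $\mathrm{X}(R)$ with the topology having $\{\mathrm{h}(\mathfrak{a})\mid \mathfrak{a}\in \mathrm{Idl}(R)\}$ as a closed subbase; the sets $\mathrm{h}(\mathfrak{a})$ are called subbasic closed sets. A space is sober if every non-empty irreducible closed subset is the closure of a unique point. *)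

theory Defs
  imports "HOL-Algebra.Ideal" "HOL-Analysis.Abstract_Topology"
begin

definition spectrum_of :: "('a, 'b) ring_scheme \<Rightarrow> 'a set set \<Rightarrow> bool" where
  "spectrum_of R X \<longleftrightarrow> X \<subseteq> {I. ideal I R} \<and> carrier R \<notin> X"

definition hull_in :: "'a set set \<Rightarrow> 'a set \<Rightarrow> 'a set set" where
  "hull_in X A = {P \<in> X. A \<subseteq> P}"

text \<open>Intersecting with the carrier gives the convention that the empty intersection is the
  whole ring.\<close>

definition kernel_in :: "('a, 'b) ring_scheme \<Rightarrow> 'a set set \<Rightarrow> 'a set" where
  "kernel_in R S = carrier R \<inter> \<Inter>S"

definition radical_in :: "('a, 'b) ring_scheme \<Rightarrow> 'a set set \<Rightarrow> 'a set \<Rightarrow> 'a set" where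
  "radical_in R X A = kernel_in R (hull_in X A)"

text \<open>The hulls form a closed subbase, so their complements in \<open>X\<close> form an open one.\<close>

definition ideal_space :: "('a, 'b) ring_scheme \<Rightarrow> 'a set set \<Rightarrow> 'a set topology" where
  "ideal_space R X = topology_generated_by {X - hull_in X A | A. ideal A R}"

text \<open>The underlying set is all of \<open>X\<close> because the hull of the unit ideal is empty.\<close>

lemma topspace_ideal_space:
  assumes "ring R" and "spectrum_of R X"
  shows "topspace (ideal_space R X) = X"
proof -
  have carr: "ideal (carrier R) R"
    using assms(1) by (rule ring.oneideal)
  have "hull_in X (carrier R) = {}"
  proof -
    have "P = carrier R" if "P \<in> X" "carrier R \<subseteq> P" for P
    proof -
      have "ideal P R"
        using assms(2) that(1) unfolding spectrum_of_def by blast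
      then have "P \<subseteq> carrier R"
        by (meson additive_subgroup.a_subset ideal.axioms(1))
      with that(2) show ?thesis by blast
    qed
    then show ?thesis
      using assms(2) unfolding hull_in_def spectrum_of_def by blast
  qed
  then have "X \<in> {X - hull_in X A | A. ideal A R}"
    using carr by blast
  then show ?thesis
    unfolding ideal_space_def topology_generated_by_topspace by blast
qed

lemma closedin_hull_in:
  assumes "ring R" and "spectrum_of R X" and "ideal A R"
  shows "closedin (ideal_space R X) (hull_in X A)"
proof -
  have "openin (ideal_space R X) (X - hull_in X A)"
    unfolding ideal_space_def
    by (rule topology_generated_by_Basis) (use assms(3) in blast)
  moreover have "hull_in X A \<subseteq> X"
    unfolding hull_in_def by blast
  ultimately show ?thesis
    by (simp add: closedin_def topspace_ideal_space[OF assms(1,2)])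
qed

text \<open>Irreducibility in the subspace topology. The empty set is not excluded here;
  nonemptiness is required separately wherever it is needed.\<close>

definition irreducible_in :: "'a topology \<Rightarrow> 'a set \<Rightarrow> bool" where
  "irreducible_in T S \<longleftrightarrow> S \<subseteq> topspace T \<and>
     (\<forall>A B. closedin (subtopology T S) A \<longrightarrow> closedin (subtopology T S) B \<longrightarrow>
        S = A \<union> B \<longrightarrow> S = A \<or> S = B)"

definition sober_space :: "'a topology \<Rightarrow> bool" where
  "sober_space T \<longleftrightarrow>
     (\<forall>S. closedin T S \<longrightarrow> S \<noteq> {} \<longrightarrow> irreducible_in T S \<longrightarrow>
        (\<exists>!x. x \<in> topspace T \<and> S = T closure_of {x}))"

end

theory Submission
  imports Defs
begin

text \<open>The hulls are only a subbase of closed sets, so a closed set need not be a hull. An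
  irreducible set, however, that lies in a union of two hulls lies in one of them. Hence the
  closure of an irreducible set \<open>S\<close> is an intersection of hulls, and in fact the hull of the
  kernel of \<open>S\<close> (\<open>closure_of_irreducible\<close>). This has two consequences: every closed irreducible
  set is a hull, and the closure of a point \<open>P\<close> is the hull of \<open>P\<close>. A generic point of a hull is
  therefore the same thing as a least element of it, and a hull has a least element exactly if
  it contains its own kernel, which is the radical of the ideal that defines it. Uniqueness of
  generic points is automatic, because a least element is unique.\<close>

lemma spectrum_of_idealD: "spectrum_of R X \<Longrightarrow> P \<in> X \<Longrightarrow> ideal P R"
  unfolding spectrum_of_def by blast

lemma ideal_kernel_in:
  assumes "ring R" "spectrum_of R X" "S \<subseteq> X"
  shows "ideal (kernel_in R S) R"
proof -
  have "ideal (\<Inter>(insert (carrier R) S)) R"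
    using assms ring.oneideal[OF assms(1)] spectrum_of_idealD[OF assms(2)]
    by (intro ring.i_Intersect) auto
  then show ?thesis
    by (simp add: kernel_in_def)
qed

lemma subset_hull_in_kernel_in: "S \<subseteq> X \<Longrightarrow> S \<subseteq> hull_in X (kernel_in R S)"
  unfolding hull_in_def kernel_in_def by blast

lemma subset_hull_in_iff:
  assumes "ideal A R" "S \<subseteq> X"
  shows "S \<subseteq> hull_in X A \<longleftrightarrow> A \<subseteq> kernel_in R S"
  using assms additive_subgroup.a_subset[OF ideal.axioms(1)[OF assms(1)]]
  unfolding hull_in_def kernel_in_def by blast

lemma kernel_in_singleton: "ideal P R \<Longrightarrow> kernel_in R {P} = P"
  using additive_subgroup.a_subset[OF ideal.axioms(1)] unfolding kernel_in_def by fastforce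

lemma kernel_in_hull_in:
  assumes "ideal P R" "P \<in> X"
  shows "kernel_in R (hull_in X P) = P"
  using assms additive_subgroup.a_subset[OF ideal.axioms(1)[OF assms(1)]]
  unfolding hull_in_def kernel_in_def by blast

lemma irreducible_in_singleton: "x \<in> topspace T \<Longrightarrow> irreducible_in T {x}"
  unfolding irreducible_in_def by blast

lemma irreducible_in_disjoint_open:
  assumes "irreducible_in T S" "openin T U" "openin T V" "U \<inter> V \<inter> S = {}"
  shows "U \<inter> S = {} \<or> V \<inter> S = {}"
proof -
  have sub: "S \<subseteq> topspace T"
    using assms(1) unfolding irreducible_in_def by blast
  have closed: "closedin (subtopology T S) (S - W)" if "openin T W" for W
  proof -
    have "S - W = (topspace T - W) \<inter> S"
      using sub by blast
    then show ?thesis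
      using that unfolding closedin_subtopology by blast
  qed
  have "S = (S - U) \<union> (S - V)"
    using assms(4) by blast
  then have "S = S - U \<or> S = S - V"
    using assms(1) closed[OF assms(2)] closed[OF assms(3)] unfolding irreducible_in_def by metis
  then show ?thesis
    by blast
qed

text \<open>The open sets for which the claim holds contain the subbase and are closed under unions
  for trivial reasons. Irreducibility is what makes them closed under binary intersections: if
  \<open>U \<inter> V\<close> misses \<open>S\<close>, then \<open>U\<close> or \<open>V\<close> already does.\<close>

lemma irreducible_separating_hull:
  assumes "spectrum_of R X" "irreducible_in (ideal_space R X) S" "S \<subseteq> X"
    and "openin (ideal_space R X) U" "P \<in> U" "U \<inter> S = {}"
  obtains B where "ideal B R" "S \<subseteq> hull_in X B" "P \<notin> hull_in X B"
proof -
  let ?\<B> = "{X - hull_in X A | A. ideal A R}"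
  have "generate_topology_on ?\<B> U"
    using assms(4) by (simp add: ideal_space_def openin_topology_generated_by_iff)
  then have "\<exists>B. ideal B R \<and> S \<subseteq> hull_in X B \<and> P \<notin> hull_in X B"
    using assms(5,6)
  proof (induction rule: generate_topology_on.induct)
    case Empty
    then show ?case by simp
  next
    case (Int U V)
    have "openin (ideal_space R X) U" "openin (ideal_space R X) V"
      using Int.hyps by (simp_all add: ideal_space_def openin_topology_generated_by_iff)
    then have "U \<inter> S = {} \<or> V \<inter> S = {}"
      using assms(2) Int.prems(2) by (intro irreducible_in_disjoint_open) auto
    then show ?case
      using Int.IH Int.prems(1) by blast
  next
    case (UN K)
    then show ?case by blast
  next
    case (Basis U)
    then show ?case
      using assms(3) by blast
  qed
  then show ?thesis
    using that by blast
qed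

text \<open>By \<open>irreducible_separating_hull\<close> the closure of \<open>S\<close> is the intersection of the hulls
  that contain \<open>S\<close>. These are the hulls of the ideals inside the kernel of \<open>S\<close>, and the kernel
  itself gives the smallest of them.\<close>

lemma closure_of_irreducible:
  assumes "ring R" "spectrum_of R X" "irreducible_in (ideal_space R X) S"
  shows "ideal_space R X closure_of S = hull_in X (kernel_in R S)"
proof
  have top: "topspace (ideal_space R X) = X"
    using assms(1,2) by (rule topspace_ideal_space)
  then have sub: "S \<subseteq> X"
    using assms(3) unfolding irreducible_in_def by blast
  have "closedin (ideal_space R X) (hull_in X (kernel_in R S))"
    using assms(1,2) sub by (intro closedin_hull_in ideal_kernel_in)
  then show "ideal_space R X closure_of S \<subseteq> hull_in X (kernel_in R S)"
    using subset_hull_in_kernel_in[OF sub] by (intro closure_of_minimal)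
  show "hull_in X (kernel_in R S) \<subseteq> ideal_space R X closure_of S"
  proof
    fix P assume P: "P \<in> hull_in X (kernel_in R S)"
    have "U \<inter> S \<noteq> {}" if U: "openin (ideal_space R X) U" "P \<in> U" for U
    proof
      assume "U \<inter> S = {}"
      then obtain B where B: "ideal B R" "S \<subseteq> hull_in X B" "P \<notin> hull_in X B"
        using irreducible_separating_hull[OF assms(2,3) sub U] by blast
      then have "B \<subseteq> kernel_in R S"
        using subset_hull_in_iff sub by blast
      then show False
        using B(3) P unfolding hull_in_def by blast
    qed
    moreover have "P \<in> X"
      using P unfolding hull_in_def by blast
    ultimately show "P \<in> ideal_space R X closure_of S"
      unfolding in_closure_of top by blast
  qed
qed

lemma closure_of_point:
  assumes "ring R" "spectrum_of R X" "P \<in> X"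
  shows "ideal_space R X closure_of {P} = hull_in X P"
proof -
  have "irreducible_in (ideal_space R X) {P}"
    using assms by (simp add: irreducible_in_singleton topspace_ideal_space)
  then show ?thesis
    using closure_of_irreducible[OF assms(1,2)]
    by (simp add: kernel_in_singleton spectrum_of_idealD[OF assms(2,3)])
qed

theorem theorem3p18:
  fixes R :: "('a, 'b) ring_scheme" and X :: "'a set set"
  assumes "cring R" and "spectrum_of R X"
  shows "sober_space (ideal_space R X) \<longleftrightarrow>
    (\<forall>A. ideal A R \<longrightarrow> hull_in X A \<noteq> {} \<longrightarrow> irreducible_in (ideal_space R X) (hull_in X A) \<longrightarrow>
       radical_in R X A \<in> hull_in X A)"
proof
  have ring: "ring R"
    using assms(1) by (rule cring.axioms(1))
  note top = topspace_ideal_space[OF ring assms(2)]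
  note point = closure_of_point[OF ring assms(2)]
  note kernel = kernel_in_hull_in[OF spectrum_of_idealD[OF assms(2)]]
  {
    assume sober: "sober_space (ideal_space R X)"
    show "\<forall>A. ideal A R \<longrightarrow> hull_in X A \<noteq> {} \<longrightarrow>
      irreducible_in (ideal_space R X) (hull_in X A) \<longrightarrow> radical_in R X A \<in> hull_in X A"
    proof (intro allI impI)
      fix A assume A: "ideal A R" "hull_in X A \<noteq> {}"
        "irreducible_in (ideal_space R X) (hull_in X A)"
      obtain P where P: "P \<in> X" "hull_in X A = ideal_space R X closure_of {P}"
        using sober A closedin_hull_in[OF ring assms(2) A(1)] top
        unfolding sober_space_def by metis
      then have eq: "hull_in X A = hull_in X P"
        using point by simp
      then have "radical_in R X A = P"
        using kernel P(1) by (simp add: radical_in_def)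
      moreover have "P \<in> hull_in X P"
        using P(1) unfolding hull_in_def by blast
      ultimately show "radical_in R X A \<in> hull_in X A"
        using eq by simp
    qed
  next
    assume rad: "\<forall>A. ideal A R \<longrightarrow> hull_in X A \<noteq> {} \<longrightarrow>
      irreducible_in (ideal_space R X) (hull_in X A) \<longrightarrow> radical_in R X A \<in> hull_in X A"
    show "sober_space (ideal_space R X)"
      unfolding sober_space_def
    proof (intro allI impI)
      fix S assume S: "closedin (ideal_space R X) S" "S \<noteq> {}" "irreducible_in (ideal_space R X) S"
      let ?K = "kernel_in R S"
      have "S \<subseteq> X"
        using closedin_subset[OF S(1)] top by simp
      then have K: "ideal ?K R"
        by (rule ideal_kernel_in[OF ring assms(2)])
      have hull: "hull_in X ?K = S"
        using closure_of_irreducible[OF ring assms(2) S(3)] closure_of_closedin[OF S(1)] by simp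
      then have "radical_in R X ?K \<in> S"
        using rad K S(2,3) by metis
      \<comment> \<open>As \<open>S\<close> is the hull of its kernel, the radical of the kernel is the kernel.\<close>
      then have "?K \<in> X"
        using hull \<open>S \<subseteq> X\<close> by (auto simp: radical_in_def)
      then have generic: "?K \<in> topspace (ideal_space R X) \<and> S = ideal_space R X closure_of {?K}"
        using point hull top by simp
      show "\<exists>!P. P \<in> topspace (ideal_space R X) \<and> S = ideal_space R X closure_of {P}"
      proof (rule ex1I[of _ ?K])
        show "?K \<in> topspace (ideal_space R X) \<and> S = ideal_space R X closure_of {?K}"
          by (fact generic)
      next
        fix P assume "P \<in> topspace (ideal_space R X) \<and> S = ideal_space R X closure_of {P}"
        then have "P \<in> X" "S = hull_in X P"
          using point top by auto
        then show "P = ?K"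
          using kernel by simp
      qed
    qed
  }
qed

end
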